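(* Let $d\in\{2,3\}$ and let $\Omega,V\subset\mathbb{R}^d$ be Lipschitz domains that are isomorphic to the unit ball and compactly embedded in the hyper-cube $\Omega_{\rm box}\subset\mathbb{R}^d$. Let $\{x_i\}_{i=1}^N\subset\partial\Omega$ be an $\epsilon$-cover of $\partial\Omega$, that is, $\sup_{x\in\partial\Omega}{\rm dist}(x,\{x_i\}_{i=1}^N)=\epsilon$. Let $\Phi:\Omega\to\mathbb{R}^d$ be a Lipschitz bijective map (a bijection onto its image) with Lipschitz constant $K$, and let $\{y_i\}_{i=1}^N\subset\partial V$. Then $$ {\rm dist}_{\rm bnd}(\Phi(\Omega);V)\;\le\;\max_{i=1,\ldots,N}\|\Phi(x_i)-y_i\|_2+K\epsilon . $$ Moreover, $$ \max_{i=1,\ldots,N}\|\Phi(x_i)-y_i\|_2\le\sqrt{d}\,\max_{i=1,\ldots,N}\|\Phi(x_i)-y_i\|_\infty=\sqrt{d}\,\|B\Phi-\mathbf{z}\|_\infty . $$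
   Context: For $x\in\mathbb{R}^d$ and a set $\omega\subset\mathbb{R}^d$, ${\rm dist}(x,\omega)=\inf_{y\in\omega}\|x-y\|_2$. The non-symmetric boundary distance between two domains is ${\rm dist}_{\rm bnd}(U;V)=\sup_{x\in\partial U}{\rm dist}(x,\partial V)$. The term "isomorphic to the unit ball" is used interchangeably with "diffeomorphic to the unit ball". Values of $\Phi$ on $\partial\Omega$ are understood through the Lipschitz extension of $\Phi$ to $\overline{\Omega}$. The vector $B\Phi\in\mathbb{R}^{dN}$ collects all components of the image points, $B\Phi=\big((\Phi(x_1))_1,\ldots,(\Phi(x_N))_1,\ldots,(\Phi(x_1))_d,\ldots,(\Phi(x_N))_d\big)^{T}$, and $\mathbf{z}=\big((y_1)_1,\ldots,(y_N)_1,\ldots,(y_1)_d,\ldots,(y_N)_d\big)^{T}\in\mathbb{R}^{dN}$. *)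

theory Defs
  imports "HOL-Analysis.Analysis"
begin

section \<open>Lipschitz domains\<close>

text \<open>
  Near each boundary point the set is the strict epigraph of a Lipschitz function, in
  orthonormal coordinates that may depend on the point. The coordinates are given by a unit
  vector \<open>e\<close> (the vertical direction): \<open>p\<close> has height \<open>p \<bullet> e\<close> and
  horizontal part \<open>p - (p \<bullet> e) *\<^sub>R e\<close>, and \<open>\<gamma>\<close> lives on the hyperplane
  orthogonal to \<open>e\<close>. In the open ball the strict epigraph determines the boundary: it is
  the graph of \<open>\<gamma>\<close>.
\<close>

definition lipschitz_domain :: "'a::euclidean_space set \<Rightarrow> bool" where
  "lipschitz_domain U \<longleftrightarrow>
     open U \<and> connected U \<and> U \<noteq> {} \<and>
     (\<forall>q\<in>frontier U. \<exists>r e \<gamma> L.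
        r > 0 \<and> norm e = 1 \<and> L-lipschitz_on {v. v \<bullet> e = 0} (\<gamma> :: 'a \<Rightarrow> real) \<and>
        U \<inter> ball q r = {p \<in> ball q r. \<gamma> (p - (p \<bullet> e) *\<^sub>R e) < p \<bullet> e})"

section \<open>Diffeomorphisms of open sets\<close>

definition C1_on :: "'a::euclidean_space set \<Rightarrow> ('a \<Rightarrow> 'b::euclidean_space) \<Rightarrow> bool" where
  "C1_on S f \<longleftrightarrow>
     (\<exists>f'. (\<forall>x\<in>S. (f has_derivative blinfun_apply (f' x)) (at x)) \<and> continuous_on S f')"

text \<open>
  A diffeomorphism is a \<open>C\<^sup>1\<close> bijection with \<open>C\<^sup>1\<close> inverse; this is implied
  by the corresponding property for any higher smoothness class. The definition is meant for
  open sets only.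
\<close>

definition diffeomorphic :: "'a::euclidean_space set \<Rightarrow> 'b::euclidean_space set \<Rightarrow> bool" where
  "diffeomorphic S T \<longleftrightarrow> (\<exists>f g. homeomorphism S T f g \<and> C1_on S f \<and> C1_on T g)"

section \<open>Compact embedding in a hyper-cube\<close>

definition hypercube :: "'a::euclidean_space set \<Rightarrow> bool" where
  "hypercube Q \<longleftrightarrow> (\<exists>a s. s > 0 \<and> Q = box a (a + s *\<^sub>R One))"

definition compactly_embedded :: "'a::topological_space set \<Rightarrow> 'a set \<Rightarrow> bool" where
  "compactly_embedded A B \<longleftrightarrow> compact (closure A) \<and> closure A \<subseteq> interior B"

section \<open>Non-symmetric boundary distance\<close>

text \<open>
  The supremum is a real number, so it is meaningful for nonempty bounded boundaries.
  \<^const>\<open>infdist\<close> is the distance to a set.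
\<close>

definition dist_bnd :: "'a::euclidean_space set \<Rightarrow> 'a set \<Rightarrow> real" where
  "dist_bnd U V = (SUP x\<in>frontier U. infdist x (frontier V))"

section \<open>Extension to the closure\<close>

definition closure_ext ::
    "'a::metric_space set \<Rightarrow> ('a \<Rightarrow> 'b::complete_space) \<Rightarrow> 'a \<Rightarrow> 'b" where
  "closure_ext S f p = (if p \<in> S then f p else Lim (at p within S) f)"

lemma closure_ext_eq:
  assumes g: "continuous_on (closure S) g" "\<And>p. p \<in> S \<Longrightarrow> g p = f p" and p: "p \<in> closure S"
  shows "closure_ext S f p = g p"
proof (cases "p \<in> S")
  case True
  then show ?thesis by (simp add: closure_ext_def g)
next
  case False
  then have nb: "at p within S \<noteq> bot"
    using p by (auto simp: closure_def trivial_limit_within)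
  have "(g \<longlongrightarrow> g p) (at p within S)"
    using g(1) p closure_subset unfolding continuous_on_def by (blast intro: tendsto_within_subset)
  then have "(f \<longlongrightarrow> g p) (at p within S)"
    by (rule Lim_transform_within[of _ _ _ _ 1]) (auto simp: g(2))
  then show ?thesis
    using False nb by (simp add: closure_ext_def tendsto_Lim)
qed

lemma lipschitz_on_closure_ext:
  assumes "K-lipschitz_on S f"
  shows "K-lipschitz_on (closure S) (closure_ext S f)"
proof -
  obtain g where g: "K-lipschitz_on (closure S) g" "\<And>p. p \<in> S \<Longrightarrow> g p = f p"
    using lipschitz_extend_closure[OF assms] by metis
  have "closure_ext S f p = g p" if "p \<in> closure S" for p
    using closure_ext_eq[OF lipschitz_on_continuous_on[OF g(1)] g(2) that] by simp
  then show ?thesis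
    using lipschitz_on_transform[OF g(1)] by metis
qed

section \<open>Vectors collecting all components\<close>

text \<open>
  The vector of length \<open>d N\<close> is indexed by pairs (component \<open>k\<close>, point \<open>i\<close>),
  listed component by component in the order \<open>(1,1),\<dots>,(1,N),\<dots>,(d,1),\<dots>,(d,N)\<close>.
\<close>

definition stack :: "('m::finite \<Rightarrow> real^'d) \<Rightarrow> real^('d::finite \<times> 'm)" where
  "stack p = (\<chi> j. p (snd j) $ fst j)"

end

theory Submission
  imports Defs
begin

text \<open>
  The extension \<open>\<Phi>\<close> maps the compact closure of \<open>\<Omega>\<close> onto the closure of \<open>\<Phi>(\<Omega>)\<close>,
  and \<open>\<Phi>(\<Omega>)\<close> is open by invariance of domain, so every boundary point of \<open>\<Phi>(\<Omega>)\<close>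
  is the image of a boundary point \<open>p\<close> of \<open>\<Omega>\<close>. If \<open>x\<^sub>i\<close> is the sample point nearest
  to \<open>p\<close>, the triangle inequality through \<open>\<Phi>(x\<^sub>i)\<close> bounds the distance from \<open>\<Phi>(p)\<close>
  to \<open>y\<^sub>i\<close>.
\<close>

lemma frontier_image_subset_closure_ext:
  fixes f :: "'a::euclidean_space \<Rightarrow> 'a"
  assumes S: "open S" "bounded S" and inj: "inj_on f S" and lip: "K-lipschitz_on S f"
  shows "frontier (f ` S) \<subseteq> closure_ext S f ` frontier S"
proof -
  let ?g = "closure_ext S f"
  have g_eq: "?g p = f p" if "p \<in> S" for p
    using that by (simp add: closure_ext_def)
  have "continuous_on (closure S) ?g"
    by (rule lipschitz_on_continuous_on[OF lipschitz_on_closure_ext[OF lip]])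
  then have "closed (?g ` closure S)"
    using S by (intro compact_imp_closed compact_continuous_image) auto
  moreover have "f ` S \<subseteq> ?g ` closure S"
    using g_eq closure_subset by (metis image_cong image_mono)
  ultimately have clo: "closure (f ` S) \<subseteq> ?g ` closure S"
    by (rule closure_minimal[rotated])
  \<comment> \<open>Invariance of domain applies because \<open>f\<close> maps a Euclidean space to
    itself, so the dimensions agree. Openness keeps frontier points of the image outside the image,
    which excludes a preimage in \<open>S\<close>.\<close>
  have op: "open (f ` S)"
    by (rule invariance_of_domain[OF lipschitz_on_continuous_on[OF lip] S(1) inj])
  show ?thesis
  proof
    fix q assume "q \<in> frontier (f ` S)"
    then have q: "q \<in> closure (f ` S)" "q \<notin> f ` S"
      using op by (auto simp: frontier_def interior_open)
    from q(1) clo obtain p where p: "p \<in> closure S" "q = ?g p"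
      by blast
    then have "p \<notin> S"
      using q(2) g_eq by auto
    with p show "q \<in> ?g ` frontier S"
      using S(1) by (auto simp: frontier_def interior_open)
  qed
qed

lemma dist_bnd_image_le:
  fixes f :: "'a::euclidean_space \<Rightarrow> 'a" and x y :: "'m::finite \<Rightarrow> 'a"
  assumes S: "open S" "bounded S" "S \<noteq> {}"
    and inj: "inj_on f S" and lip: "K-lipschitz_on S f"
    and x: "range x \<subseteq> frontier S" and y: "range y \<subseteq> frontier V"
  shows "dist_bnd (f ` S) V
           \<le> (MAX i. norm (closure_ext S f (x i) - y i)) + K * (SUP p\<in>frontier S. infdist p (range x))"
proof -
  let ?g = "closure_ext S f" and ?\<epsilon> = "SUP p\<in>frontier S. infdist p (range x)"
  have lip_g: "K-lipschitz_on (closure S) ?g"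
    by (rule lipschitz_on_closure_ext[OF lip])
  have K: "K \<ge> 0"
    by (rule lipschitz_on_nonneg[OF lip])
  have cpt: "compact (frontier S)"
    using S(2) by (rule compact_frontier_bounded)
  \<comment> \<open>A real \<open>SUP\<close> dominates its terms only if they are bounded above;
    this holds here by continuity on a compact frontier.\<close>
  have "compact ((\<lambda>p. infdist p (range x)) ` frontier S)"
    by (intro compact_continuous_image cpt continuous_intros)
  then have bdd: "bdd_above ((\<lambda>p. infdist p (range x)) ` frontier S)"
    by (intro bounded_imp_bdd_above compact_imp_bounded)
  \<comment> \<open>The supremum in \<open>dist_bnd\<close> must range over a nonempty set. A
    nonempty bounded image is not the whole space, hence has a nonempty frontier.\<close>
  have "bounded (f ` S)"
  proof (rule bounded_subset)
    show "bounded (?g ` closure S)"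
      using S(2) lipschitz_on_continuous_on[OF lip_g]
      by (intro compact_imp_bounded compact_continuous_image) auto
    show "f ` S \<subseteq> ?g ` closure S"
      using closure_subset by (force simp: closure_ext_def)
  qed
  then have "f ` S \<noteq> UNIV"
    using not_bounded_UNIV by metis
  then have ne: "frontier (f ` S) \<noteq> {}"
    using S(3) by (simp add: frontier_not_empty)
  show ?thesis
    unfolding dist_bnd_def
  proof (rule cSUP_least[OF ne])
    fix q assume "q \<in> frontier (f ` S)"
    then obtain p where p: "p \<in> frontier S" "q = ?g p"
      using frontier_image_subset_closure_ext[OF S(1,2) inj lip] by blast
    have "closed (range x)"
      by (simp add: finite_imp_closed)
    then obtain i where i: "infdist p (range x) = dist p (x i)"
      using infdist_attains_inf[of "range x" p] by auto
    have "dist p (x i) \<le> ?\<epsilon>"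
      using cSUP_upper[OF p(1) bdd] by (simp add: i)
    then have \<epsilon>: "K * dist p (x i) \<le> K * ?\<epsilon>"
      using K by (rule mult_left_mono)
    \<comment> \<open>Both points lie on the frontier of the open set \<open>S\<close>, so the
      Lipschitz bound has to be that of the extension.\<close>
    have "p \<in> closure S" "x i \<in> closure S"
      using p(1) x by (auto simp: frontier_def)
    then have "dist (?g p) (?g (x i)) \<le> K * dist p (x i)"
      by (rule lipschitz_onD[OF lip_g])
    moreover have "dist (?g (x i)) (y i) \<le> (MAX i. norm (?g (x i) - y i))"
      by (simp add: dist_norm)
    \<comment> \<open>Any point of the frontier of \<open>V\<close> bounds the infimum from above;
      \<open>y i\<close> need not be the one nearest to \<open>q\<close>.\<close>
    moreover have "infdist q (frontier V) \<le> dist q (y i)"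
      using y by (intro infdist_le) auto
    ultimately show "infdist q (frontier V) \<le> (MAX i. norm (?g (x i) - y i)) + K * ?\<epsilon>"
      using \<epsilon> dist_triangle[of "?g p" "y i" "?g (x i)"] by (simp add: p(2))
  qed
qed

lemma infnorm_cart_Max:
  fixes v :: "real^'n"
  shows "infnorm v = (MAX k. \<bar>v $ k\<bar>)"
  by (simp add: infnorm_cart full_SetCompr_eq cSup_eq_Max)

text \<open>Both sides are the maximum of the same numbers \<open>\<bar>p i $ k\<bar>\<close>: the
  left takes it over all pairs at once, the right first over \<open>k\<close> and then over
  \<open>i\<close>.\<close>

lemma infnorm_stack:
  fixes p :: "'m::finite \<Rightarrow> real^'d"
  shows "infnorm (stack p) = (MAX i. infnorm (p i))"
proof (rule antisym)
  show "infnorm (stack p) \<le> (MAX i. infnorm (p i))"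
    unfolding infnorm_cart_Max[of "stack p"]
  proof (intro Max.boundedI; clarsimp)
    fix k i
    have "\<bar>stack p $ (k, i)\<bar> \<le> infnorm (p i)"
      by (simp add: stack_def component_le_infnorm_cart)
    also have "\<dots> \<le> (MAX i. infnorm (p i))"
      by simp
    finally show "\<bar>stack p $ (k, i)\<bar> \<le> (MAX i. infnorm (p i))" .
  qed
  have "\<bar>p i $ k\<bar> \<le> infnorm (stack p)" for i k
    using component_le_infnorm_cart[of "stack p" "(k, i)"] by (simp add: stack_def)
  then show "(MAX i. infnorm (p i)) \<le> infnorm (stack p)"
    by (auto simp: infnorm_cart_Max)
qed

lemma stack_diff: "stack p - stack q = stack (\<lambda>i. p i - q i)"
  by (simp add: stack_def vec_eq_iff)

theorem proposition3p1:
  fixes \<Omega> V \<Omega>box :: "(real^'d) set"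
    and \<Phi> :: "real^'d \<Rightarrow> real^'d"
    and x y :: "'m::finite \<Rightarrow> real^'d"
    and K \<epsilon> :: real
  assumes "CARD('d) \<in> {2, 3}"
    and "lipschitz_domain \<Omega>" and "lipschitz_domain V"
    and "diffeomorphic \<Omega> (ball (0 :: real^'d) 1)" and "diffeomorphic V (ball (0 :: real^'d) 1)"
    and "hypercube \<Omega>box"
    and "compactly_embedded \<Omega> \<Omega>box" and "compactly_embedded V \<Omega>box"
    and "range x \<subseteq> frontier \<Omega>"
    and "(SUP p\<in>frontier \<Omega>. infdist p (range x)) = \<epsilon>"
    and "inj_on \<Phi> \<Omega>" and "K-lipschitz_on \<Omega> \<Phi>"
    and "range y \<subseteq> frontier V"
  shows "dist_bnd (\<Phi> ` \<Omega>) V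
           \<le> (MAX i. norm (closure_ext \<Omega> \<Phi> (x i) - y i)) + K * \<epsilon>
       \<and> (MAX i. norm (closure_ext \<Omega> \<Phi> (x i) - y i))
           \<le> sqrt (real CARD('d)) * (MAX i. infnorm (closure_ext \<Omega> \<Phi> (x i) - y i))
       \<and> sqrt (real CARD('d)) * (MAX i. infnorm (closure_ext \<Omega> \<Phi> (x i) - y i))
           = sqrt (real CARD('d)) * infnorm (stack (\<lambda>i. closure_ext \<Omega> \<Phi> (x i)) - stack y)"
proof -
  let ?v = "\<lambda>i. closure_ext \<Omega> \<Phi> (x i) - y i"
  have "bounded \<Omega>"
    using assms(7) closure_subset unfolding compactly_embedded_def
    by (meson bounded_subset compact_imp_bounded)
  then have dist: "dist_bnd (\<Phi> ` \<Omega>) V \<le> (MAX i. norm (?v i)) + K * \<epsilon>"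
    using assms(2) dist_bnd_image_le[OF _ _ _ assms(11,12,9,13)]
    by (simp add: lipschitz_domain_def assms(10))
  have "norm (?v i) \<le> sqrt (real CARD('d)) * (MAX i. infnorm (?v i))" for i
  proof -
    \<comment> \<open>The squared norm is a sum of \<open>CARD('d)\<close> squares, each at most the
      square of the \<open>infnorm\<close>.\<close>
    have "norm (?v i) \<le> sqrt (real CARD('d)) * infnorm (?v i)"
      using norm_le_infnorm[of "?v i"] by simp
    also have "\<dots> \<le> sqrt (real CARD('d)) * (MAX i. infnorm (?v i))"
      by (intro mult_left_mono) auto
    finally show ?thesis .
  qed
  then have "(MAX i. norm (?v i)) \<le> sqrt (real CARD('d)) * (MAX i. infnorm (?v i))"
    by (intro Max.boundedI) auto
  with dist show ?thesis
    by (simp add: stack_diff infnorm_stack)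
qed

end
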